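(* Let $(X,\omega_X),(Y,\omega_Y)$ be networks. Then $$d_{\mathcal N}(X,Y)=\tfrac12\min\bigl\{\max(\operatorname{dis}(\varphi),\operatorname{dis}(\psi),C_{X,Y}(\varphi,\psi),C_{Y,X}(\psi,\varphi)) : \varphi:X\to Y,\ \psi:Y\to X\text{ any maps}\bigr\}.$$
   Context: A network is a pair $(X,\omega_X)$ where $X$ is a finite (nonempty) set and $\omega_X:X\times X\to\mathbb R$ is any function. A correspondence between $X$ and $Y$ is a relation $R\subseteq X\times Y$ whose projections to $X$ and to $Y$ are both surjective; its distortion is $\operatorname{dis}(R)=\max_{(x,y),(x',y')\in R}|\omega_X(x,x')-\omega_Y(y,y')|$. The network distance is $d_{\mathcal N}(X,Y)=\frac12\min_R\operatorname{dis}(R)$, the minimum being over all correspondences $R$ between $X$ and $Y$. For maps $\varphi:X\to Y$ and $\psi:Y\to X$: $\operatorname{dis}(\varphi)=\max_{x,x'\in X}|\omega_X(x,x')-\omega_Y(\varphi(x),\varphi(x'))|$, and similarly $\operatorname{dis}(\psi)=\max_{y,y'\in Y}|\omega_Y(y,y')-\omega_X(\psi(y),\psi(y'))|$; $C_{X,Y}(\varphi,\psi)=\max_{(x,y)\in X\times Y}|\omega_X(x,\psi(y))-\omega_Y(\varphi(x),y)|$; $C_{Y,X}(\psi,\varphi)=\max_{(y,x)\in Y\times X}|\omega_Y(y,\varphi(x))-\omega_X(\psi(y),x)|$. *)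

theory Defs
  imports Complex_Main "HOL-Library.FuncSet"
begin

text \<open>A network is given by a carrier set and a weight function. The weight function is total
  on the ambient type; its values off the carrier are never used.\<close>

definition network :: "'a set \<Rightarrow> ('a \<Rightarrow> 'a \<Rightarrow> real) \<Rightarrow> bool" where
  "network X \<omega>X \<longleftrightarrow> finite X \<and> X \<noteq> {}"

definition correspondence :: "'a set \<Rightarrow> 'b set \<Rightarrow> ('a \<times> 'b) set \<Rightarrow> bool" where
  "correspondence X Y R \<longleftrightarrow> R \<subseteq> X \<times> Y \<and> fst ` R = X \<and> snd ` R = Y"

definition dis_rel ::
    "('a \<Rightarrow> 'a \<Rightarrow> real) \<Rightarrow> ('b \<Rightarrow> 'b \<Rightarrow> real) \<Rightarrow> ('a \<times> 'b) set \<Rightarrow> real" where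
  "dis_rel \<omega>X \<omega>Y R = (MAX ((x, y), (x', y')) \<in> R \<times> R. \<bar>\<omega>X x x' - \<omega>Y y y'\<bar>)"

definition network_dist ::
    "'a set \<Rightarrow> ('a \<Rightarrow> 'a \<Rightarrow> real) \<Rightarrow> 'b set \<Rightarrow> ('b \<Rightarrow> 'b \<Rightarrow> real) \<Rightarrow> real" where
  "network_dist X \<omega>X Y \<omega>Y = 1 / 2 * (MIN R \<in> {R. correspondence X Y R}. dis_rel \<omega>X \<omega>Y R)"

definition dis_map ::
    "'a set \<Rightarrow> ('a \<Rightarrow> 'a \<Rightarrow> real) \<Rightarrow> ('b \<Rightarrow> 'b \<Rightarrow> real) \<Rightarrow> ('a \<Rightarrow> 'b) \<Rightarrow> real" where
  "dis_map X \<omega>X \<omega>Y \<phi> = (MAX (x, x') \<in> X \<times> X. \<bar>\<omega>X x x' - \<omega>Y (\<phi> x) (\<phi> x')\<bar>)"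

text \<open>The quantity $C_{X,Y}(\varphi,\psi)$; exchanging the roles of the two networks and of the
  two maps gives $C_{Y,X}(\psi,\varphi)$.\<close>

definition codis ::
    "'a set \<Rightarrow> ('a \<Rightarrow> 'a \<Rightarrow> real) \<Rightarrow> 'b set \<Rightarrow> ('b \<Rightarrow> 'b \<Rightarrow> real) \<Rightarrow> ('a \<Rightarrow> 'b) \<Rightarrow> ('b \<Rightarrow> 'a) \<Rightarrow> real" where
  "codis X \<omega>X Y \<omega>Y \<phi> \<psi> = (MAX (x, y) \<in> X \<times> Y. \<bar>\<omega>X x (\<psi> y) - \<omega>Y (\<phi> x) y\<bar>)"

end

theory Submission
  imports Defs
begin

text \<open>A pair of maps \<open>\<phi>\<close>, \<open>\<psi>\<close> yields the correspondence consisting of the graph of \<open>\<phi>\<close> and the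
  transposed graph of \<open>\<psi>\<close>; the four kinds of pairs of its elements account for the four quantities
  on the right-hand side. Conversely every correspondence contains one of this form, and distortion
  is monotone under inclusion, so the minimum may be restricted to these.\<close>

definition map_pair_rel :: "'a set \<Rightarrow> 'b set \<Rightarrow> ('a \<Rightarrow> 'b) \<Rightarrow> ('b \<Rightarrow> 'a) \<Rightarrow> ('a \<times> 'b) set" where
  "map_pair_rel X Y \<phi> \<psi> = (\<lambda>x. (x, \<phi> x)) ` X \<union> (\<lambda>y. (\<psi> y, y)) ` Y"

text \<open>Bounding a maximum means bounding every term; this and the two analogous facts below let
  maxima over different index sets be compared through their upper bounds.\<close>

lemma dis_rel_le_iff:
  assumes "finite R" "R \<noteq> {}"
  shows "dis_rel \<omega>X \<omega>Y R \<le> c \<longleftrightarrow>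
    (\<forall>(x, y) \<in> R. \<forall>(x', y') \<in> R. \<bar>\<omega>X x x' - \<omega>Y y y'\<bar> \<le> c)"
  using assms unfolding dis_rel_def by (subst Max_le_iff) auto

lemma dis_map_le_iff:
  assumes "finite X" "X \<noteq> {}"
  shows "dis_map X \<omega>X \<omega>Y \<phi> \<le> c \<longleftrightarrow>
    (\<forall>x \<in> X. \<forall>x' \<in> X. \<bar>\<omega>X x x' - \<omega>Y (\<phi> x) (\<phi> x')\<bar> \<le> c)"
  using assms unfolding dis_map_def by (subst Max_le_iff) auto

lemma codis_le_iff:
  assumes "finite X" "X \<noteq> {}" "finite Y" "Y \<noteq> {}"
  shows "codis X \<omega>X Y \<omega>Y \<phi> \<psi> \<le> c \<longleftrightarrow>
    (\<forall>x \<in> X. \<forall>y \<in> Y. \<bar>\<omega>X x (\<psi> y) - \<omega>Y (\<phi> x) y\<bar> \<le> c)"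
  using assms unfolding codis_def by (subst Max_le_iff) auto

lemma dis_rel_mono:
  assumes "S \<subseteq> R" "finite R" "S \<noteq> {}"
  shows "dis_rel \<omega>X \<omega>Y S \<le> dis_rel \<omega>X \<omega>Y R"
proof -
  have "finite S" "R \<noteq> {}"
    using assms finite_subset by auto
  moreover have "\<forall>(x, y) \<in> R. \<forall>(x', y') \<in> R. \<bar>\<omega>X x x' - \<omega>Y y y'\<bar> \<le> dis_rel \<omega>X \<omega>Y R"
    using dis_rel_le_iff[OF \<open>finite R\<close> \<open>R \<noteq> {}\<close>] by blast
  ultimately show ?thesis
    using assms by (subst dis_rel_le_iff) blast+
qed

lemma dis_rel_map_pair_rel:
  assumes "finite X" "X \<noteq> {}" "finite Y" "Y \<noteq> {}"
  shows "dis_rel \<omega>X \<omega>Y (map_pair_rel X Y \<phi> \<psi>) =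
    Max {dis_map X \<omega>X \<omega>Y \<phi>, dis_map Y \<omega>Y \<omega>X \<psi>,
         codis X \<omega>X Y \<omega>Y \<phi> \<psi>, codis Y \<omega>Y X \<omega>X \<psi> \<phi>}" (is "?d = ?m")
proof -
  \<comment> \<open>Two reals with the same upper bounds are equal: instantiate \<open>c\<close>
    with each of them.\<close>
  have "?d \<le> c \<longleftrightarrow> ?m \<le> c" for c
  proof -
    have "?d \<le> c \<longleftrightarrow>
      (\<forall>p \<in> map_pair_rel X Y \<phi> \<psi>. \<forall>q \<in> map_pair_rel X Y \<phi> \<psi>.
         \<bar>\<omega>X (fst p) (fst q) - \<omega>Y (snd p) (snd q)\<bar> \<le> c)"
      using assms by (subst dis_rel_le_iff) (auto simp: map_pair_rel_def split_def)
    \<comment> \<open>Splitting both quantifiers over the union gives four cases. Those whose first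
      pair is \<open>(\<psi> y, y)\<close> match the terms of \<open>?m\<close> only after swapping
      the difference inside the absolute value.\<close>
    also have "\<dots> \<longleftrightarrow> ?m \<le> c"
      using assms
      by (simp add: dis_map_le_iff codis_le_iff map_pair_rel_def ball_Un ball_simps
          ball_conj_distrib abs_minus_commute conj_ac)
    finally show ?thesis .
  qed
  then show ?thesis
    by (meson order_antisym order_refl)
qed

lemma correspondence_map_pair_rel:
  assumes "\<phi> \<in> X \<rightarrow> Y" "\<psi> \<in> Y \<rightarrow> X"
  shows "correspondence X Y (map_pair_rel X Y \<phi> \<psi>)"
  using assms by (auto simp: correspondence_def map_pair_rel_def image_Un image_image)

text \<open>Surjectivity of the two projections lets one choose a partner in \<open>R\<close> for
  every point of \<open>X\<close> and of \<open>Y\<close>.\<close>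

lemma correspondence_contains_map_pair_rel:
  assumes "correspondence X Y R"
  obtains \<phi> \<psi> where "\<phi> \<in> X \<rightarrow>\<^sub>E Y" "\<psi> \<in> Y \<rightarrow>\<^sub>E X" "map_pair_rel X Y \<phi> \<psi> \<subseteq> R"
proof -
  have R: "R \<subseteq> X \<times> Y" "fst ` R = X" "snd ` R = Y"
    using assms by (auto simp: correspondence_def)
  have "\<forall>x \<in> X. \<exists>y. (x, y) \<in> R" "\<forall>y \<in> Y. \<exists>x. (x, y) \<in> R"
    using R(2,3) by force+
  then obtain f g where fg: "\<forall>x \<in> X. (x, f x) \<in> R" "\<forall>y \<in> Y. (g y, y) \<in> R"
    by metis
  show thesis
  proof
    \<comment> \<open>Restriction makes the choice functions extensional and keeps their values on
      the carriers.\<close>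
    show "restrict f X \<in> X \<rightarrow>\<^sub>E Y" "restrict g Y \<in> Y \<rightarrow>\<^sub>E X"
      using fg R(1) by auto
    show "map_pair_rel X Y (restrict f X) (restrict g Y) \<subseteq> R"
      using fg by (auto simp: map_pair_rel_def)
  qed
qed

lemma Min_eq_of_coinitial_subset:
  assumes "finite A" "B \<subseteq> A" "A \<noteq> {}" "\<And>a. a \<in> A \<Longrightarrow> \<exists>b \<in> B. b \<le> a"
  shows "Min A = Min B"
proof (rule antisym)
  \<comment> \<open>An element of \<open>A\<close> exists, and the last assumption places an element
    of \<open>B\<close> below it.\<close>
  have "finite B" "B \<noteq> {}"
    using assms finite_subset by auto
  then show "Min A \<le> Min B"
    using assms by (intro Min_antimono)
  \<comment> \<open>Apply the last assumption to \<open>Min A\<close> itself.\<close>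
  show "Min B \<le> Min A"
    using assms \<open>finite B\<close> by (meson Min_in Min_le order_trans)
qed

text \<open>Extensional functions represent each map between the carriers exactly once, and there
  are only finitely many of them.\<close>

theorem proposition9:
  fixes X :: "'a set" and Y :: "'b set"
    and \<omega>X :: "'a \<Rightarrow> 'a \<Rightarrow> real" and \<omega>Y :: "'b \<Rightarrow> 'b \<Rightarrow> real"
  assumes "network X \<omega>X" and "network Y \<omega>Y"
  shows "network_dist X \<omega>X Y \<omega>Y =
    1 / 2 * (MIN (\<phi>, \<psi>) \<in> (X \<rightarrow>\<^sub>E Y) \<times> (Y \<rightarrow>\<^sub>E X).
      Max {dis_map X \<omega>X \<omega>Y \<phi>, dis_map Y \<omega>Y \<omega>X \<psi>,
           codis X \<omega>X Y \<omega>Y \<phi> \<psi>, codis Y \<omega>Y X \<omega>X \<psi> \<phi>})"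
proof -
  have XY: "finite X" "X \<noteq> {}" "finite Y" "Y \<noteq> {}"
    using assms by (auto simp: network_def)
  let ?C = "{R. correspondence X Y R}" and ?M = "(X \<rightarrow>\<^sub>E Y) \<times> (Y \<rightarrow>\<^sub>E X)"
  let ?f = "\<lambda>(\<phi>, \<psi>). dis_rel \<omega>X \<omega>Y (map_pair_rel X Y \<phi> \<psi>)"
  have "Min (dis_rel \<omega>X \<omega>Y ` ?C) = Min (?f ` ?M)"
  proof (rule Min_eq_of_coinitial_subset)
    have "?C \<subseteq> Pow (X \<times> Y)"
      by (auto simp: correspondence_def)
    then show "finite (dis_rel \<omega>X \<omega>Y ` ?C)"
      using XY by (simp add: finite_subset)
    \<comment> \<open>The full product projects onto both factors because neither carrier is
      empty.\<close>
    have "correspondence X Y (X \<times> Y)"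
      using XY by (auto simp: correspondence_def)
    then show "dis_rel \<omega>X \<omega>Y ` ?C \<noteq> {}"
      by blast
    show "?f ` ?M \<subseteq> dis_rel \<omega>X \<omega>Y ` ?C"
      by (auto intro!: imageI correspondence_map_pair_rel)
  next
    fix a assume "a \<in> dis_rel \<omega>X \<omega>Y ` ?C"
    then obtain R where R: "correspondence X Y R" "a = dis_rel \<omega>X \<omega>Y R"
      by auto
    obtain \<phi> \<psi> where m: "\<phi> \<in> X \<rightarrow>\<^sub>E Y" "\<psi> \<in> Y \<rightarrow>\<^sub>E X" "map_pair_rel X Y \<phi> \<psi> \<subseteq> R"
      using correspondence_contains_map_pair_rel[OF R(1)] .
    have "finite R"
      using R(1) XY by (auto simp: correspondence_def intro: finite_subset[OF _ finite_cartesian_product])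
    \<comment> \<open>Monotonicity applies to a nonempty subrelation; here it contains the graph of
      \<open>\<phi>\<close> over the nonempty \<open>X\<close>.\<close>
    then have "?f (\<phi>, \<psi>) \<le> a"
      using m XY R(2) by (auto intro!: dis_rel_mono simp: map_pair_rel_def)
    then show "\<exists>b \<in> ?f ` ?M. b \<le> a"
      using m by blast
  qed
  then show ?thesis
    by (simp add: network_dist_def dis_rel_map_pair_rel[OF XY])
qed

end
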